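(* Let $M$ be a matroid of rank $r$ on $\{1,2,\ldots,n\}$. Then its Tutte polynomial $T(M;x,y)$ can be written as a linear combination with non-negative integer coefficients of the polynomials $\bar\gamma(\underline{a};x,y)$, where $\underline{a}$ ranges over $(n,r)$-compositions. One way to do this is $$T(M;x,y)=\sum_{\underline{a}}\nu(M;\underline{a})\,\bar\gamma(\underline{a};x,y),$$ where the sum ranges over all $(n,r)$-compositions $\underline{a}$.
   Context: The Tutte polynomial of a rank-$r$ matroid on $S$ is $T(M;x,y)=\sum_{A\subseteq S}(x-1)^{r-\mathrm{rk}(A)}(y-1)^{|A|-\mathrm{rk}(A)}$. An $(n,r)$-composition is an integer sequence $\underline{a}=a_0,a_1,\ldots,a_r$ with $a_0\ge 0$, $a_i\ge 1$ for $1\le i\le r$, and $a_0+\cdots+a_r=n$. It is identified with the bit sequence $0^{a_0}10^{a_1-1}10^{a_2-1}\cdots 10^{a_r-1}$ of length $n$ with exactly $r$ ones (an $(n,r)$-sequence). For $(n,r)$-sequences, $\underline{b}\trianglerighteq\underline{a}$ means that for every $j$ the initial segment of length $j$ of $\underline{b}$ contains at least as many $1$'s as that of $\underline{a}$. $\mathcal{G}(n,r)$ is the vector space, over a field of characteristic zero, with basis the formal symbols $[\underline{b}]$, one for each $(n,r)$-sequence $\underline{b}$. The linear map $\mathsf{Sp}$ from $\mathcal{G}(n,r)$ to polynomials in $x,y$ is given by $$[r_1\cdots r_n]\mapsto\frac1{n!}\sum_{m=0}^n\binom nm (x-1)^{r-w_m}(y-1)^{m-w_m},\qquad w_m=r_1+\cdots+r_m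 .$$ For an $(n,r)$-composition $\underline{a}$, with $(t)_k=t(t-1)\cdots(t-k+1)$, $$\gamma(\underline{a})=\sum_{\underline{b}\trianglerighteq\underline{a}}(a_0)_{b_0}\prod_{j=1}^r a_j\Big(a_j-1+\sum_{i=0}^{j-1}(a_i-b_i)\Big)_{b_j-1}[0^{b_0}10^{b_1-1}\cdots10^{b_r-1}],$$ the sum being over $(n,r)$-compositions $\underline{b}$ whose bit sequences satisfy $\underline{b}\trianglerighteq\underline{a}$. Set $\bar\gamma(\underline{a};x,y)=\mathsf{Sp}(\gamma(\underline{a}))$. $\nu(M;a_0,\ldots,a_r)$ is the number of flags (maximal chains of flats) $X_0\subset X_1\subset\cdots\subset X_r$ of $M$ with $\mathrm{rk}(X_i)=i$, $|X_0|=a_0$, and $|X_i|-|X_{i-1}|=a_i$ for $1\le i\le r$. *)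

theory Defs
  imports "HOL-Computational_Algebra.Polynomial" "HOL-Library.Poly_Mapping"
begin

locale matroid =
  fixes carrier :: "'a set" and indep :: "'a set \<Rightarrow> bool"
  assumes finite_carrier: "finite carrier"
    and indep_subset_carrier: "indep X \<Longrightarrow> X \<subseteq> carrier"
    and indep_empty: "indep {}"
    and indep_mono: "indep X \<Longrightarrow> Y \<subseteq> X \<Longrightarrow> indep Y"
    and indep_augment: "indep X \<Longrightarrow> indep Y \<Longrightarrow> card X < card Y \<Longrightarrow> \<exists>y\<in>Y - X. indep (insert y X)"

text \<open>For a matroid, the rank of the matroid itself is the rank of its carrier.\<close>

definition rk :: "('a set \<Rightarrow> bool) \<Rightarrow> 'a set \<Rightarrow> nat" where
  "rk indep A = Max (card ` {I. I \<subseteq> A \<and> indep I})"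

definition flats :: "'a set \<Rightarrow> ('a set \<Rightarrow> bool) \<Rightarrow> 'a set set" where
  "flats S indep = {X. X \<subseteq> S \<and> (\<forall>e\<in>S - X. rk indep (insert e X) > rk indep X)}"

text \<open>A flag is a maximal chain of flats, listed in strictly increasing order.\<close>

definition flags :: "'a set \<Rightarrow> ('a set \<Rightarrow> bool) \<Rightarrow> 'a set list set" where
  "flags S indep = {Xs. sorted_wrt (\<subset>) Xs \<and> subset.maxchain (flats S indep) (set Xs)}"

definition nu :: "'a set \<Rightarrow> ('a set \<Rightarrow> bool) \<Rightarrow> nat list \<Rightarrow> nat" where
  "nu S indep a = card {X \<in> flags S indep. length X = length a \<and>
     (\<forall>i<length a. rk indep (X ! i) = i) \<and>
     card (X ! 0) = a ! 0 \<and>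
     (\<forall>i. 1 \<le> i \<and> i < length a \<longrightarrow> int (card (X ! i)) - int (card (X ! (i - 1))) = int (a ! i))}"

text \<open>The polynomial ring in \<open>x\<close> and \<open>y\<close> over \<open>'k\<close> is \<open>'k poly poly\<close>, with \<open>x\<close> the
  inner and \<open>y\<close> the outer variable.\<close>

definition var_x :: "'k::comm_ring_1 poly poly" where
  "var_x = [:[:0, 1:]:]"

definition var_y :: "'k::comm_ring_1 poly poly" where
  "var_y = [:0, 1:]"

definition scale :: "'k::comm_ring_1 \<Rightarrow> 'k poly poly \<Rightarrow> 'k poly poly" where
  "scale c p = smult [:c:] p"

text \<open>The subtractions of natural numbers in exponents, here and in \<open>Sp_symbol\<close>, do not truncate:
  the rank of a set is at most the rank of the matroid and at most the size of the set.\<close>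

definition tutte :: "'a set \<Rightarrow> ('a set \<Rightarrow> bool) \<Rightarrow> 'k::comm_ring_1 poly poly" where
  "tutte S indep = (\<Sum>A\<in>Pow S.
     (var_x - 1) ^ (rk indep S - rk indep A) * (var_y - 1) ^ (card A - rk indep A))"

definition compositions :: "nat \<Rightarrow> nat \<Rightarrow> nat list set" where
  "compositions n r = {a. length a = r + 1 \<and> (\<forall>i\<in>{1..r}. 1 \<le> a ! i) \<and> (\<Sum>i\<le>r. a ! i) = n}"

text \<open>Bits are booleans, with \<open>True\<close> for \<open>1\<close>.\<close>

definition sequences :: "nat \<Rightarrow> nat \<Rightarrow> bool list set" where
  "sequences n r = {s. length s = n \<and> count_list s True = r}"

definition bits :: "nat list \<Rightarrow> bool list" where
  "bits a = replicate (a ! 0) False @ concat (map (\<lambda>k. True # replicate (k - 1) False) (tl a))"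

definition dominates :: "bool list \<Rightarrow> bool list \<Rightarrow> bool"  (infix "\<unrhd>" 50) where
  "s \<unrhd> t \<longleftrightarrow> (\<forall>j. count_list (take j t) True \<le> count_list (take j s) True)"

text \<open>\<open>bool list \<Rightarrow>\<^sub>0 'k\<close> is the free vector space on all bit sequences, the symbol \<open>[s]\<close>
  being \<open>Poly_Mapping.single s 1\<close>.\<close>

definition G :: "nat \<Rightarrow> nat \<Rightarrow> (bool list \<Rightarrow>\<^sub>0 'k::field_char_0) set" where
  "G n r = {g. Poly_Mapping.keys g \<subseteq> sequences n r}"

definition Sp_symbol :: "nat \<Rightarrow> nat \<Rightarrow> bool list \<Rightarrow> 'k::field_char_0 poly poly" where
  "Sp_symbol n r s = (let w = (\<lambda>m. count_list (take m s) True) in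
     scale (1 / fact n) (\<Sum>m\<le>n. of_nat (n choose m) * (var_x - 1) ^ (r - w m) * (var_y - 1) ^ (m - w m)))"

definition Sp :: "nat \<Rightarrow> nat \<Rightarrow> (bool list \<Rightarrow>\<^sub>0 'k::field_char_0) \<Rightarrow> 'k poly poly" where
  "Sp n r g = (\<Sum>s\<in>Poly_Mapping.keys g. scale (Poly_Mapping.lookup g s) (Sp_symbol n r s))"

definition falling :: "int \<Rightarrow> nat \<Rightarrow> int" where
  "falling t k = (\<Prod>i<k. t - int i)"

definition gamma_coeff :: "nat \<Rightarrow> nat list \<Rightarrow> nat list \<Rightarrow> int" where
  "gamma_coeff r a b = falling (int (a ! 0)) (b ! 0) *
     (\<Prod>j=1..r. int (a ! j) *
        falling (int (a ! j) - 1 + (\<Sum>i<j. int (a ! i) - int (b ! i))) (b ! j - 1))"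

definition gamma :: "nat \<Rightarrow> nat \<Rightarrow> nat list \<Rightarrow> (bool list \<Rightarrow>\<^sub>0 'k::field_char_0)" where
  "gamma n r a = (\<Sum>b\<in>{b \<in> compositions n r. bits b \<unrhd> bits a}.
     Poly_Mapping.single (bits b) (of_int (gamma_coeff r a b)))"

definition gamma_bar :: "nat \<Rightarrow> nat \<Rightarrow> nat list \<Rightarrow> 'k::field_char_0 poly poly" where
  "gamma_bar n r a = Sp n r (gamma n r a)"

lemma finite_compositions: "finite (compositions n r)"
proof (rule finite_subset)
  show "compositions n r \<subseteq> {a. set a \<subseteq> {..n} \<and> length a = r + 1}"
  proof
    fix a assume a: "a \<in> compositions n r"
    have "a ! i \<le> n" if "i \<le> r" for i
      using member_le_sum[of i "{..r}" "\<lambda>i. a ! i"] that a by (auto simp: compositions_def)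
    then show "a \<in> {a. set a \<subseteq> {..n} \<and> length a = r + 1}"
      using a by (auto simp: compositions_def in_set_conv_nth)
  qed
  show "finite {a. set a \<subseteq> {..n} \<and> length a = r + 1}"
    by (rule finite_lists_length_eq) simp
qed

lemma bits_in_sequences:
  assumes "a \<in> compositions n r"
  shows "bits a \<in> sequences n r"
proof -
  obtain k ks where a: "a = k # ks" and len: "length ks = r"
    using assms by (cases a) (auto simp: compositions_def)
  have pos: "\<forall>k\<in>set ks. 1 \<le> k"
  proof
    fix m assume "m \<in> set ks"
    then obtain i where "i < r" "m = ks ! i" by (auto simp: in_set_conv_nth len)
    then have "m = a ! Suc i" "Suc i \<in> {1..r}" by (auto simp: a)
    then show "1 \<le> m" using assms unfolding compositions_def by blast
  qed
  have "sum_list a = (\<Sum>i\<le>r. a ! i)"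
    by (simp add: sum_list_sum_nth a len atLeast0LessThan lessThan_Suc_atMost)
  then have sum: "k + sum_list ks = n" using assms by (simp add: compositions_def a)
  have "length (concat (map (\<lambda>k. True # replicate (k - 1) False) ks)) = sum_list ks \<and>
        count_list (concat (map (\<lambda>k. True # replicate (k - 1) False) ks)) True = length ks"
    using pos by (induction ks) (auto simp: count_list_0_iff)
  then show ?thesis
    using sum len by (auto simp: sequences_def bits_def a count_list_0_iff)
qed

lemma gamma_in_G: "(gamma n r a :: bool list \<Rightarrow>\<^sub>0 'k::field_char_0) \<in> G n r"
proof -
  have "Poly_Mapping.keys (gamma n r a :: bool list \<Rightarrow>\<^sub>0 'k) \<subseteq> (\<Union>b\<in>{b \<in> compositions n r. bits b \<unrhd> bits a}.
     Poly_Mapping.keys (Poly_Mapping.single (bits b) (of_int (gamma_coeff r a b) :: 'k)))"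
    unfolding gamma_def by (rule keys_sum)
  also have "\<dots> \<subseteq> sequences n r"
    using bits_in_sequences by auto
  finally show ?thesis by (simp add: G_def)
qed

lemma Sp_superset:
  assumes "finite A" "Poly_Mapping.keys g \<subseteq> A"
  shows "Sp n r g = (\<Sum>s\<in>A. scale (Poly_Mapping.lookup g s) (Sp_symbol n r s))"
  unfolding Sp_def using assms
  by (intro sum.mono_neutral_left) (auto simp: in_keys_iff scale_def)

lemma Sp_single: "Sp n r (Poly_Mapping.single s c) = scale c (Sp_symbol n r s)"
  by (subst Sp_superset[of "{s}"]) auto

lemma Sp_add: "Sp n r (g + h) = Sp n r g + Sp n r h"
proof -
  let ?A = "Poly_Mapping.keys g \<union> Poly_Mapping.keys h"
  have "Sp n r (g + h) = (\<Sum>s\<in>?A. scale (Poly_Mapping.lookup (g + h) s) (Sp_symbol n r s))"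
    by (rule Sp_superset) (use Poly_Mapping.keys_add[of g h] in auto)
  moreover have "scale (a + b) p = scale a p + scale b p" for a b and p :: "'a poly poly"
    unfolding scale_def by (metis add_0_right add_pCons smult_add_left)
  ultimately show ?thesis
    by (simp add: Sp_superset[of ?A g] Sp_superset[of ?A h] lookup_add sum.distrib)
qed

lemma Sp_scale: "Sp n r (Poly_Mapping.map ((*) c) g) = scale c (Sp n r g)"
proof -
  have lookup: "Poly_Mapping.lookup (Poly_Mapping.map ((*) c) g) s = c * Poly_Mapping.lookup g s" for s
    by (simp add: map.rep_eq when_def)
  have "Sp n r (Poly_Mapping.map ((*) c) g) =
    (\<Sum>s\<in>Poly_Mapping.keys g. scale (Poly_Mapping.lookup (Poly_Mapping.map ((*) c) g) s) (Sp_symbol n r s))"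
    by (rule Sp_superset) (auto simp: in_keys_iff lookup)
  moreover have "scale (c * d) p = scale c (scale d p)" for d and p :: "'a poly poly"
    by (simp add: scale_def mult.commute)
  moreover have "scale c (sum f A) = (\<Sum>s\<in>A. scale c (f s))" for f :: "bool list \<Rightarrow> 'a poly poly" and A
    by (induction A rule: infinite_finite_induct) (simp_all add: scale_def smult_add_right)
  ultimately show ?thesis
    by (simp add: Sp_def lookup)
qed

end

theory Submission
  imports Defs "HOL-Combinatorics.Multiset_Permutations"
begin

text \<open>An ordering of the ground set has a rank sequence, recording at which steps the rank of the
  initial segment grows. Applying \<open>Sp\<close> to the sum of the rank sequences of all orderings gives the
  Tutte polynomial, since an \<open>m\<close>-set is an initial segment of \<open>m! (n - m)!\<close> orderings. On the other
  hand the closures of the initial segments of an ordering form a flag, and the coefficient of \<open>b\<close>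
  in \<open>\<gamma>(a)\<close> counts the orderings with rank sequence \<open>b\<close> that induce a given flag of type \<open>a\<close>.
  Sequences not dominating \<open>a\<close> do not occur, because the initial segment of rank \<open>i\<close> lies in
  the \<open>i\<close>-th flat.\<close>

subsection \<open>Rank and closure\<close>

context matroid
begin

lemma finite_indep: "indep I \<Longrightarrow> finite I"
  using indep_subset_carrier finite_carrier finite_subset by blast

lemma finite_indep_subsets: "finite {I. I \<subseteq> A \<and> indep I}"
  by (rule finite_subset[of _ "Pow carrier"]) (use indep_subset_carrier finite_carrier in auto)

lemma card_le_rk: "I \<subseteq> A \<Longrightarrow> indep I \<Longrightarrow> card I \<le> rk indep A"
  unfolding rk_def using finite_indep_subsets[of A] by (intro Max_ge) auto

lemma basis_exists: "\<exists>I. I \<subseteq> A \<and> indep I \<and> card I = rk indep A"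
proof -
  have "rk indep A \<in> card ` {I. I \<subseteq> A \<and> indep I}"
    unfolding rk_def using finite_indep_subsets[of A] indep_empty by (intro Max_in) auto
  then show ?thesis by auto
qed

lemma rk_mono: "A \<subseteq> B \<Longrightarrow> rk indep A \<le> rk indep B"
proof -
  assume "A \<subseteq> B"
  moreover obtain I where "I \<subseteq> A" "indep I" "card I = rk indep A" using basis_exists by blast
  ultimately show ?thesis using card_le_rk[of I B] by auto
qed

lemma rk_empty: "rk indep {} = 0"
  using basis_exists[of "{}"] by auto

lemma rk_insert_le: "rk indep (insert x A) \<le> Suc (rk indep A)"
proof -
  obtain I where I: "I \<subseteq> insert x A" "indep I" "card I = rk indep (insert x A)"
    using basis_exists by blast
  have "card (I - {x}) \<le> rk indep A"
    using I indep_mono by (intro card_le_rk) auto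
  moreover have "card I \<le> Suc (card (I - {x}))"
    using finite_indep[OF I(2)] by (cases "x \<in> I") (simp_all add: card_Suc_Diff1)
  ultimately show ?thesis using I by simp
qed

text \<open>Induction on the deficit \<open>rk indep A - card I\<close>: as long as \<open>I\<close>
  is smaller than a basis of \<open>A\<close>, augmentation supplies an element of that basis to
  add.\<close>

lemma indep_extend_basis:
  assumes "indep I" "I \<subseteq> A"
  shows "\<exists>J. I \<subseteq> J \<and> J \<subseteq> A \<and> indep J \<and> card J = rk indep A"
  using assms
proof (induction "rk indep A - card I" arbitrary: I)
  case 0
  then have "card I = rk indep A" using card_le_rk[of I A] by linarith
  then show ?case using 0 by blast
next
  case (Suc d)
  obtain B where B: "B \<subseteq> A" "indep B" "card B = rk indep A" using basis_exists by blast
  have "card I < card B" using B Suc.hyps(2) by linarith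
  then obtain y where y: "y \<in> B - I" "indep (insert y I)"
    using indep_augment[of I B] Suc.prems B by blast
  have "card (insert y I) = Suc (card I)" using y finite_indep[OF Suc.prems(1)] by simp
  then have "d = rk indep A - card (insert y I)" using Suc.hyps(2) by simp
  then show ?case using Suc.hyps(1)[of "insert y I"] y B Suc.prems by blast
qed

text \<open>Diminishing returns of the rank. Extend a basis \<open>I\<close> of \<open>A\<close> to
  a basis \<open>J\<close> of \<open>B\<close>. If \<open>x\<close> raised the rank of
  \<open>B\<close>, augmenting \<open>J\<close> inside \<open>insert x B\<close> would be forced to
  add \<open>x\<close>, and then \<open>insert x I\<close> would be independent and too large for
  \<open>insert x A\<close>.\<close>

lemma rk_insert_eq_mono:
  assumes "A \<subseteq> B" and "rk indep (insert x A) = rk indep A"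
  shows "rk indep (insert x B) = rk indep B"
proof (rule ccontr)
  assume "rk indep (insert x B) \<noteq> rk indep B"
  then have less: "rk indep B < rk indep (insert x B)"
    using rk_mono[OF subset_insertI[of B x]] by linarith
  obtain I where I: "I \<subseteq> A" "indep I" "card I = rk indep A" using basis_exists by blast
  obtain J where J: "I \<subseteq> J" "J \<subseteq> B" "indep J" "card J = rk indep B"
    using indep_extend_basis[of I B] I assms by blast
  obtain K where K: "K \<subseteq> insert x B" "indep K" "card K = rk indep (insert x B)"
    using basis_exists by blast
  obtain y where y: "y \<in> K - J" "indep (insert y J)"
    using indep_augment[of J K] J K less by auto
  have "card (insert y J) = Suc (rk indep B)" using y J finite_indep by simp
  then have "y \<notin> B" using card_le_rk[of "insert y J" B] J y by auto
  then have "y = x" using y K by auto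
  then have "indep (insert x I)" "x \<notin> I" using y J indep_mono[of "insert x J" "insert x I"] by auto
  then show False
    using card_le_rk[of "insert x I" "insert x A"] I assms finite_indep[of I] by auto
qed

lemma rk_union_eq:
  assumes "finite Y" and "\<And>y. y \<in> Y \<Longrightarrow> rk indep (insert y A) = rk indep A"
  shows "rk indep (A \<union> Y) = rk indep A"
  using assms
proof (induction Y rule: finite_induct)
  case (insert y Y)
  then have "rk indep (insert y (A \<union> Y)) = rk indep (A \<union> Y)"
    using rk_insert_eq_mono[of A "A \<union> Y" y] by blast
  then show ?case using insert by simp
qed simp

text \<open>Elements outside the ground set never raise the rank, so membership in
  \<open>carrier\<close> has to be imposed.\<close>

definition closure :: "'a set \<Rightarrow> 'a set" where
  "closure A = {x \<in> carrier. rk indep (insert x A) = rk indep A}"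

lemma closure_extensive: "A \<subseteq> carrier \<Longrightarrow> A \<subseteq> closure A"
  by (auto simp: closure_def insert_absorb)

lemma closure_mono: "A \<subseteq> B \<Longrightarrow> closure A \<subseteq> closure B"
  unfolding closure_def using rk_insert_eq_mono by blast

lemma rk_closure: "A \<subseteq> carrier \<Longrightarrow> rk indep (closure A) = rk indep A"
proof -
  assume "A \<subseteq> carrier"
  then have "A \<union> closure A = closure A" using closure_extensive by blast
  moreover have "finite (closure A)" using finite_carrier by (simp add: closure_def)
  then have "rk indep (A \<union> closure A) = rk indep A"
    by (rule rk_union_eq) (simp add: closure_def)
  ultimately show ?thesis by simp
qed

lemma closure_flat: "A \<subseteq> carrier \<Longrightarrow> closure A \<in> flats carrier indep"
proof -
  assume A: "A \<subseteq> carrier"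
  have "rk indep (closure A) < rk indep (insert e (closure A))" if "e \<in> carrier - closure A" for e
  proof -
    have "rk indep A < rk indep (insert e A)"
      using that rk_mono[OF subset_insertI[of A e]] by (auto simp: closure_def)
    also have "\<dots> \<le> rk indep (insert e (closure A))"
      using closure_extensive[OF A] by (intro rk_mono) auto
    finally show ?thesis using rk_closure[OF A] by simp
  qed
  then show ?thesis by (auto simp: flats_def closure_def)
qed

text \<open>Elements of \<open>F\<close> cannot raise the rank of \<open>A\<close>, which is already
  that of \<open>F\<close>. An element that does not raise the rank of \<open>A\<close> does not
  raise that of \<open>F\<close> either, and a flat contains all such elements. This recovers a flat
  from any subset of full rank.\<close>

lemma closure_eq_flat:
  assumes "F \<in> flats carrier indep" "A \<subseteq> F" "rk indep A = rk indep F"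
  shows "closure A = F"
proof
  show "F \<subseteq> closure A"
  proof
    fix x assume x: "x \<in> F"
    have "rk indep (insert x A) \<le> rk indep F" "rk indep A \<le> rk indep (insert x A)"
      using rk_mono[of "insert x A" F] rk_mono[OF subset_insertI[of A x]] x assms(2) by blast+
    then show "x \<in> closure A" using x assms by (auto simp: closure_def flats_def)
  qed
  show "closure A \<subseteq> F"
  proof
    fix x assume x: "x \<in> closure A"
    then have "x \<in> carrier" "rk indep (insert x F) = rk indep F"
      using rk_insert_eq_mono[OF assms(2)] by (simp_all add: closure_def)
    then show "x \<in> F" using assms(1) unfolding flats_def by (metis (mono_tags, lifting) DiffI less_irrefl mem_Collect_eq)
  qed
qed

text \<open>Both flats are the closure of \<open>E\<close>.\<close>

lemma flat_eqI:
  assumes "E \<in> flats carrier indep" "F \<in> flats carrier indep" "E \<subseteq> F"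
    and "rk indep E = rk indep F"
  shows "E = F"
  using closure_eq_flat[OF assms(1) order_refl refl] closure_eq_flat[OF assms(2-4)] by (rule trans[OF sym])

end

subsection \<open>Orderings adapted to a flag\<close>

text \<open>Blocks of lengths \<open>b 0, \<dots>, b k\<close>: block \<open>0\<close> lies in \<open>X 0\<close>; block \<open>j + 1\<close> starts in
  \<open>X (j + 1) - X j\<close> and stays in \<open>X (j + 1)\<close>.\<close>

primrec adapted :: "(nat \<Rightarrow> 'a set) \<Rightarrow> (nat \<Rightarrow> nat) \<Rightarrow> nat \<Rightarrow> 'a list set" where
  "adapted X b 0 = {ys. distinct ys \<and> set ys \<subseteq> X 0 \<and> length ys = b 0}"
| "adapted X b (Suc k) = {xs @ x # ys | xs x ys. xs \<in> adapted X b k \<and> x \<in> X (Suc k) - X k \<and>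
     distinct ys \<and> set ys \<subseteq> X (Suc k) - insert x (set xs) \<and> length ys = b (Suc k) - 1}"

text \<open>The sequence \<open>bits\<close>, built by appending the last block, so that it unfolds
  in step with \<open>adapted\<close>.\<close>

primrec bit_blocks :: "(nat \<Rightarrow> nat) \<Rightarrow> nat \<Rightarrow> bool list" where
  "bit_blocks b 0 = replicate (b 0) False"
| "bit_blocks b (Suc k) = bit_blocks b k @ True # replicate (b (Suc k) - 1) False"

lemma adapted_cong:
  "(\<And>i. i \<le> k \<Longrightarrow> X i = Y i) \<Longrightarrow> (\<And>i. i \<le> k \<Longrightarrow> b i = c i) \<Longrightarrow> adapted X b k = adapted Y c k"
  by (induction k) simp_all

text \<open>Positivity of \<open>b i\<close> is what makes the leading element and its
  \<open>b i - 1\<close> followers add up to \<open>b i\<close>.\<close>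

lemma adaptedD:
  assumes "xs \<in> adapted X b k" "\<And>i. i < k \<Longrightarrow> X i \<subseteq> X (Suc i)" "\<And>i. 1 \<le> i \<Longrightarrow> i \<le> k \<Longrightarrow> 1 \<le> b i"
  shows "distinct xs \<and> set xs \<subseteq> X k \<and> length xs = (\<Sum>i\<le>k. b i)"
  using assms
proof (induction k arbitrary: xs)
  case (Suc k)
  obtain ys x zs where xs: "xs = ys @ x # zs" "ys \<in> adapted X b k" "x \<in> X (Suc k) - X k"
    "distinct zs" "set zs \<subseteq> X (Suc k) - insert x (set ys)" "length zs = b (Suc k) - 1"
    using Suc.prems(1) by auto
  have ys: "distinct ys \<and> set ys \<subseteq> X k \<and> length ys = (\<Sum>i\<le>k. b i)"
    by (rule Suc.IH[OF xs(2)]) (use Suc.prems in auto)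
  have "X k \<subseteq> X (Suc k)" "1 \<le> b (Suc k)" using Suc.prems by auto
  then show ?case using xs ys by auto
qed auto

text \<open>Cutting at the end of block \<open>i\<close> leaves a list adapted to the shorter chain.
  This gives access to the single flats of a flag and to the partial sums of
  \<open>b\<close>.\<close>

lemma take_adapted:
  assumes "xs \<in> adapted X b k" "\<And>i. i < k \<Longrightarrow> X i \<subseteq> X (Suc i)" "\<And>i. 1 \<le> i \<Longrightarrow> i \<le> k \<Longrightarrow> 1 \<le> b i"
    and "i \<le> k"
  shows "take (\<Sum>l\<le>i. b l) xs \<in> adapted X b i"
  using assms
proof (induction k arbitrary: xs)
  case 0
  then show ?case using adaptedD[OF 0(1)] by simp
next
  case (Suc k)
  show ?case
  proof (cases "i = Suc k")
    case True
    have "length xs = (\<Sum>l\<le>i. b l)" using adaptedD[OF Suc.prems(1-3)] True by blast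
    then have "take (\<Sum>l\<le>i. b l) xs = xs" by simp
    then show ?thesis using Suc.prems(1) True by simp
  next
    case False
    then have i: "i \<le> k" using Suc.prems by simp
    obtain ys x zs where xs: "xs = ys @ x # zs" "ys \<in> adapted X b k" using Suc.prems(1) by auto
    have ys: "length ys = (\<Sum>i\<le>k. b i)" using adaptedD[OF xs(2)] Suc.prems by auto
    have "(\<Sum>l\<le>i. b l) \<le> (\<Sum>l\<le>k. b l)" by (rule sum_mono2) (use i in auto)
    then have "take (\<Sum>l\<le>i. b l) xs = take (\<Sum>l\<le>i. b l) ys" using xs ys by simp
    then show ?thesis using Suc.IH[OF xs(2)] Suc.prems i by simp
  qed
qed

text \<open>The case of an element that stays in the current flat: it joins the last block. For
  \<open>k > 0\<close> the bound on \<open>b k\<close> keeps the truncated \<open>b k - 1\<close> in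
  step with the new length.\<close>

lemma adapted_snoc:
  assumes "xs \<in> adapted X b k" "x \<in> X k" "x \<notin> set xs" "1 \<le> k \<Longrightarrow> 1 \<le> b k"
  shows "xs @ [x] \<in> adapted X (b(k := Suc (b k))) k"
proof (cases k)
  case 0
  then show ?thesis using assms by auto
next
  case (Suc l)
  obtain ys y zs where xs: "xs = ys @ y # zs" "ys \<in> adapted X b l" "y \<in> X (Suc l) - X l"
    "distinct zs" "set zs \<subseteq> X (Suc l) - insert y (set ys)" "length zs = b (Suc l) - 1"
    using assms(1) Suc by auto
  have "ys \<in> adapted X (b(k := Suc (b k))) l"
    using xs(2) Suc adapted_cong[of l X X b "b(k := Suc (b k))"] by simp
  moreover have "xs @ [x] = ys @ y # (zs @ [x])" using xs by simp
  moreover have "distinct (zs @ [x])" "set (zs @ [x]) \<subseteq> X (Suc l) - insert y (set ys)"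
    "length (zs @ [x]) = Suc (b k) - 1"
    using xs assms Suc by auto
  ultimately show ?thesis using xs(3) unfolding Suc adapted.simps fun_upd_same by blast
qed

section \<open>Counting adapted lists\<close>

lemma card_distinct_lists:
  assumes "finite A"
  shows "int (card {ys. distinct ys \<and> set ys \<subseteq> A \<and> length ys = k}) = falling (int (card A)) k"
proof (cases "k \<le> card A")
  case True
  have "{ys. distinct ys \<and> set ys \<subseteq> A \<and> length ys = k} = {ys. length ys = k \<and> distinct ys \<and> set ys \<subseteq> A}"
    by auto
  then have "int (card {ys. distinct ys \<and> set ys \<subseteq> A \<and> length ys = k}) = (\<Prod>i=card A - k + 1..card A. int i)"
    using card_lists_distinct_length_eq[OF assms True] by simp
  \<comment> \<open>The same factors in reverse order, hence the involution
    \<open>i \<mapsto> card A - i\<close>.\<close>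
  also have "\<dots> = falling (int (card A)) k"
    unfolding falling_def using True
    by (intro prod.reindex_bij_witness[of _ "\<lambda>i. card A - i" "\<lambda>i. card A - i"]) auto
  finally show ?thesis .
next
  case False
  have "{ys. distinct ys \<and> set ys \<subseteq> A \<and> length ys = k} = {}"
  proof -
    have False if "distinct ys" "set ys \<subseteq> A" "length ys = k" for ys
      using that False card_mono[OF assms, of "set ys"] distinct_card[of ys] by simp
    then show ?thesis by blast
  qed
  \<comment> \<open>The factor with index \<open>card A\<close> vanishes.\<close>
  moreover have "falling (int (card A)) k = 0"
    unfolding falling_def using False by (intro prod_zero) (auto intro!: bexI[of _ "card A"])
  ultimately show ?thesis by (simp only: card.empty of_nat_0)
qed

lemma finite_adapted: "(\<And>i. i \<le> k \<Longrightarrow> finite (X i)) \<Longrightarrow> finite (adapted X b k)"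
proof (induction k)
  case 0
  have "adapted X b 0 \<subseteq> {ys. set ys \<subseteq> X 0 \<and> length ys = b 0}" by auto
  then show ?case using finite_lists_length_eq[of "X 0"] 0 finite_subset by fastforce
next
  case (Suc k)
  have "adapted X b (Suc k) \<subseteq> (\<lambda>(xs, x, ys). xs @ x # ys) `
    (adapted X b k \<times> X (Suc k) \<times> {ys. set ys \<subseteq> X (Suc k) \<and> length ys = b (Suc k) - 1})"
    by force
  moreover have "finite (adapted X b k \<times> X (Suc k) \<times> {ys. set ys \<subseteq> X (Suc k) \<and> length ys = b (Suc k) - 1})"
    using Suc finite_lists_length_eq[of "X (Suc k)"] by auto
  ultimately show ?case using finite_subset by blast
qed

lemma card_adapted:
  assumes "\<And>i. i \<le> k \<Longrightarrow> finite (X i)" "\<And>i. i < k \<Longrightarrow> X i \<subseteq> X (Suc i)"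
    and "\<And>i. 1 \<le> i \<Longrightarrow> i \<le> k \<Longrightarrow> 1 \<le> b i"
    and "card (X 0) = a 0" "\<And>i. i < k \<Longrightarrow> card (X (Suc i)) = card (X i) + a (Suc i)"
  shows "int (card (adapted X b k)) = falling (int (a 0)) (b 0) *
     (\<Prod>j=1..k. int (a j) * falling (int (a j) - 1 + (\<Sum>i<j. int (a i) - int (b i))) (b j - 1))"
  using assms
proof (induction k)
  case 0
  then show ?case by (simp add: card_distinct_lists)
next
  case (Suc k)
  let ?L = "\<lambda>xs x. {ys. distinct ys \<and> set ys \<subseteq> X (Suc k) - insert x (set xs) \<and> length ys = b (Suc k) - 1}"
  let ?D = "X (Suc k) - X k"
  let ?f = "falling (int (a (Suc k)) - 1 + (\<Sum>i<Suc k. int (a i) - int (b i))) (b (Suc k) - 1)"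
  have fin: "finite (X (Suc k))" "finite (X k)" using Suc.prems by auto
  have sub: "X k \<subseteq> X (Suc k)" using Suc.prems by auto
  have lists: "distinct xs \<and> set xs \<subseteq> X k \<and> length xs = (\<Sum>i\<le>k. b i)" if "xs \<in> adapted X b k" for xs
    by (rule adaptedD[OF that]) (use Suc.prems in auto)
  have cX: "card (X m) = (\<Sum>i\<le>m. a i)" if "m \<le> Suc k" for m
    using that by (induction m) (use Suc.prems in auto)
  have cD: "card ?D = a (Suc k)"
    using sub fin Suc.prems(5)[of k] by (simp add: card_Diff_subset)
  have finL: "finite (?L xs x)" for xs x
    by (rule finite_subset[OF _ finite_lists_length_eq[of "X (Suc k)" "b (Suc k) - 1"]]) (use fin in auto)
  have cL: "int (card (?L xs x)) = ?f" if xs: "xs \<in> adapted X b k" and x: "x \<in> ?D" for xs x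
  proof -
    have "x \<notin> set xs" "insert x (set xs) \<subseteq> X (Suc k)" using lists[OF xs] x sub by auto
    then have "int (card (X (Suc k) - insert x (set xs))) = int (card (X (Suc k))) - int (card (insert x (set xs)))"
      using fin card_mono[of "X (Suc k)" "insert x (set xs)"]
      by (subst card_Diff_subset) (simp_all add: of_nat_diff)
    also have "\<dots> = int (\<Sum>i\<le>Suc k. a i) - (int (\<Sum>i\<le>k. b i) + 1)"
      using \<open>x \<notin> set xs\<close> lists[OF xs] cX[of "Suc k"] distinct_card[of xs] by simp
    also have "\<dots> = int (a (Suc k)) - 1 + (\<Sum>i<Suc k. int (a i) - int (b i))"
      by (simp add: sum_subtractf lessThan_Suc_atMost)
    finally show ?thesis using card_distinct_lists[of "X (Suc k) - insert x (set xs)"] fin by simp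
  qed
  have "adapted X b (Suc k) = (\<lambda>(xs, x, ys). xs @ x # ys) ` (SIGMA xs:adapted X b k. SIGMA x:?D. ?L xs x)"
    by (force simp: image_iff)
  \<comment> \<open>All lists in \<open>adapted X b k\<close> have the same length, so the position
    of the split is known.\<close>
  moreover have "inj_on (\<lambda>(xs, x, ys). xs @ x # ys) (SIGMA xs:adapted X b k. SIGMA x:?D. ?L xs x)"
    using lists by (auto simp: inj_on_def)
  ultimately have "card (adapted X b (Suc k)) = card (SIGMA xs:adapted X b k. SIGMA x:?D. ?L xs x)"
    by (simp add: card_image)
  also have "\<dots> = (\<Sum>xs\<in>adapted X b k. \<Sum>x\<in>?D. card (?L xs x))"
    using fin finL finite_adapted[of k X b] Suc.prems(1) by (simp add: card_SigmaI)
  finally have "int (card (adapted X b (Suc k))) = (\<Sum>xs\<in>adapted X b k. \<Sum>x\<in>?D. int (card (?L xs x)))"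
    by simp
  \<comment> \<open>The count \<open>?f\<close> is used only where some \<open>xs\<close> and
    \<open>x\<close> exist. Without them both sides are zero, so a negative argument of
    \<open>falling\<close> does no harm.\<close>
  also have "\<dots> = (\<Sum>xs\<in>adapted X b k. \<Sum>x\<in>?D. ?f)"
    by (intro sum.cong refl cL)
  also have "\<dots> = int (card (adapted X b k)) * (int (a (Suc k)) * ?f)"
    using cD by simp
  finally show ?case using Suc by (simp add: mult.assoc)
qed

subsection \<open>Bit sequences of compositions\<close>

lemma bits_eq_bit_blocks:
  assumes "length a = Suc r"
  shows "bits a = bit_blocks ((!) a) r"
  using assms
proof (induction r arbitrary: a)
  case 0
  then show ?case by (auto simp: bits_def length_Suc_conv)
next
  case (Suc r)
  then have len: "length a = Suc (Suc r)" by simp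
  define b where "b = butlast a"
  have "a \<noteq> []" using len by auto
  then have a: "a = b @ [a ! Suc r]"
    using len append_butlast_last_id[of a] last_conv_nth[of a] by (simp add: b_def)
  have lb: "length b = Suc r" using len b_def by simp
  have "bits a = bits b @ True # replicate (a ! Suc r - 1) False"
    using lb by (subst a) (cases b, auto simp: bits_def nth_append)
  also have "bits b = bit_blocks ((!) b) r" using Suc.IH[OF lb] .
  also have "bit_blocks ((!) b) r = bit_blocks ((!) a) r"
  proof -
    have "\<forall>i\<le>r. b ! i = a ! i" using lb by (subst a) (auto simp: nth_append)
    then have "m \<le> r \<Longrightarrow> bit_blocks ((!) b) m = bit_blocks ((!) a) m" for m
      by (induction m) auto
    then show ?thesis by simp
  qed
  finally show ?case by simp
qed

section \<open>Lengths, prefixes and dominance of block sequences\<close>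

lemma bit_blocks_length:
  "(\<And>i. 1 \<le> i \<Longrightarrow> i \<le> k \<Longrightarrow> 1 \<le> b i) \<Longrightarrow> length (bit_blocks b k) = (\<Sum>i\<le>k. b i)"
proof (induction k)
  case (Suc k)
  have "1 \<le> b (Suc k)" using Suc.prems by simp
  moreover have "length (bit_blocks b k) = (\<Sum>i\<le>k. b i)" using Suc by simp
  ultimately show ?case by simp
qed simp

lemma bit_blocks_count: "count_list (bit_blocks b k) True = k"
  by (induction k) (auto simp: count_list_0_iff)

lemma bit_blocks_prefix:
  "i < k \<Longrightarrow> \<exists>zs. bit_blocks b k = bit_blocks b i @ True # zs"
  by (induction k) (auto simp: less_Suc_eq)

lemma count_list_take_mono: "i \<le> j \<Longrightarrow> count_list (take i xs) x \<le> count_list (take j xs) x"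
  using take_add[of i "j - i" xs] by simp

text \<open>The partial sum up to \<open>i\<close> is the number of bits before one number
  \<open>i + 1\<close>, so \<open>le\<close> says that each one of \<open>b\<close> comes no later
  than its counterpart in \<open>a\<close>. If the first \<open>j\<close> bits of \<open>b\<close>
  hold \<open>i\<close> ones, then \<open>j\<close> is at most the partial sum of \<open>b\<close>,
  hence at most that of \<open>a\<close>, and the first \<open>j\<close> bits of \<open>a\<close>
  hold at most \<open>i\<close> ones.\<close>

lemma bit_blocks_dominates:
  assumes a: "\<And>i. 1 \<le> i \<Longrightarrow> i \<le> r \<Longrightarrow> 1 \<le> a i" and b: "\<And>i. 1 \<le> i \<Longrightarrow> i \<le> r \<Longrightarrow> 1 \<le> b i"
    and le: "\<And>i. i \<le> r \<Longrightarrow> (\<Sum>l\<le>i. b l) \<le> (\<Sum>l\<le>i. a l)"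
  shows "bit_blocks b r \<unrhd> bit_blocks a r"
  unfolding dominates_def
proof (rule allI, rule ccontr)
  fix j
  let ?i = "count_list (take j (bit_blocks b r)) True"
  assume "\<not> count_list (take j (bit_blocks a r)) True \<le> ?i"
  then have less: "?i < count_list (take j (bit_blocks a r)) True" by simp
  also have "\<dots> \<le> r"
    using count_list_append[of "take j (bit_blocks a r)" "drop j (bit_blocks a r)" True]
    by (simp add: bit_blocks_count)
  finally have ir: "?i < r" .
  obtain us vs where us: "bit_blocks b r = bit_blocks b ?i @ True # us"
    and vs: "bit_blocks a r = bit_blocks a ?i @ True # vs"
    using bit_blocks_prefix[OF ir] by blast
  have lb: "length (bit_blocks b ?i) = (\<Sum>l\<le>?i. b l)" and la: "length (bit_blocks a ?i) = (\<Sum>l\<le>?i. a l)"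
    using ir by (auto intro!: bit_blocks_length a b)
  have "j \<le> (\<Sum>l\<le>?i. b l)"
  proof (rule ccontr)
    assume "\<not> j \<le> (\<Sum>l\<le>?i. b l)"
    then have "Suc (length (bit_blocks b ?i)) \<le> j" using lb by simp
    then have "count_list (take (Suc (length (bit_blocks b ?i))) (bit_blocks b r)) True \<le> ?i"
      by (rule count_list_take_mono)
    moreover have "take (Suc (length (bit_blocks b ?i))) (bit_blocks b r) = bit_blocks b ?i @ [True]"
      by (subst us) simp
    ultimately show False by (simp add: bit_blocks_count)
  qed
  then have "j \<le> length (bit_blocks a ?i)" using le[of ?i] ir la by simp
  then have "count_list (take j (bit_blocks a r)) True \<le> count_list (take (length (bit_blocks a ?i)) (bit_blocks a r)) True"
    by (rule count_list_take_mono)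
  also have "\<dots> = ?i" by (subst vs) (simp add: bit_blocks_count)
  finally show False using less by simp
qed

text \<open>The leading zeros determine the head. Removing them and the one that follows turns the
  next entry \<open>m\<close> into a head \<open>m - 1\<close>.\<close>

lemma bits_inj:
  assumes "\<forall>k\<in>set ks. 1 \<le> k" "\<forall>k\<in>set ls. 1 \<le> k" "bits (k # ks) = bits (l # ls)"
  shows "k = l \<and> ks = ls"
  using assms
proof (induction ks arbitrary: k l ls)
  case Nil
  then show ?case
  proof (cases ls)
    case (Cons m ms)
    then have "True \<in> set (bits (l # ls))" by (simp add: bits_def)
    moreover have "True \<notin> set (bits [k])" by (simp add: bits_def)
    ultimately show ?thesis using Nil(3) by simp
  qed (auto simp: bits_def)
next
  case (Cons m ms)
  have tw: "takeWhile Not (bits (c # cs)) = replicate c False" for c cs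
  proof -
    have "takeWhile Not (replicate c False @ zs) = replicate c False @ takeWhile Not zs" for zs
      by (induction c) auto
    then show ?thesis by (cases cs) (auto simp: bits_def)
  qed
  have k: "k = l" using arg_cong[OF Cons.prems(3), of "\<lambda>z. length (takeWhile Not z)"] by (simp add: tw)
  have "ls \<noteq> []"
    using Cons.prems(3) unfolding k by (auto simp: bits_def)
  then obtain q qs where ls: "ls = q # qs" by (cases ls) auto
  \<comment> \<open>A head may be zero, so the induction hypothesis applies even if
    \<open>m = 1\<close>.\<close>
  have "bits ((m - 1) # ms) = bits ((q - 1) # qs)"
    using Cons.prems(3) unfolding k ls by (simp add: bits_def)
  then have "m - 1 = q - 1 \<and> ms = qs"
    using Cons.IH[of qs "m - 1" "q - 1"] Cons.prems ls by auto
  moreover have "1 \<le> m" "1 \<le> q" using Cons.prems ls by auto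
  ultimately show ?case using k ls by auto
qed

lemma bits_inj_on_compositions: "inj_on bits (compositions n r)"
proof (rule inj_onI)
  fix a b assume ab: "a \<in> compositions n r" "b \<in> compositions n r" "bits a = bits b"
  have pos: "\<forall>k\<in>set (tl c). 1 \<le> k" if "c \<in> compositions n r" for c
    using that unfolding compositions_def
    by (auto simp: in_set_conv_nth nth_tl)
  obtain k ks l ls where "a = k # ks" "b = l # ls"
    using ab by (cases a; cases b) (auto simp: compositions_def)
  then show "a = b" using bits_inj[of ks ls k l] pos[of a] pos[of b] ab by simp
qed


subsection \<open>The rank sequence of an ordering\<close>

context matroid
begin

definition rank_bits :: "'a list \<Rightarrow> bool list" where
  "rank_bits xs = map (\<lambda>i. rk indep (set (take i xs)) < rk indep (set (take (Suc i) xs))) [0..<length xs]"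

lemma rank_bits_Nil [simp]: "rank_bits [] = []"
  by (simp add: rank_bits_def)

lemma rank_bits_snoc:
  "rank_bits (xs @ [x]) = rank_bits xs @ [rk indep (set xs) < rk indep (insert x (set xs))]"
  by (simp add: rank_bits_def)

lemma take_rank_bits: "take m (rank_bits xs) = rank_bits (take m xs)"
  by (auto simp: rank_bits_def take_map take_upt min_def)

text \<open>Each step raises the rank by at most one, so the rank equals the number of steps at
  which it grows. Together with \<open>take_rank_bits\<close> this identifies \<open>w m\<close> in
  \<open>Sp_symbol\<close> with the rank of the first \<open>m\<close> elements.\<close>

lemma count_rank_bits: "count_list (rank_bits xs) True = rk indep (set xs)"
proof (induction xs rule: rev_induct)
  case (snoc x xs)
  show ?case
    using snoc rk_insert_le[of x "set xs"] rk_mono[OF subset_insertI[of "set xs" x]]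
    by (simp add: rank_bits_snoc)
qed (simp add: rk_empty)

text \<open>The ranks of the intermediate segments are squeezed between two equal values.\<close>

lemma rank_bits_append:
  assumes "rk indep (set (xs @ ys)) = rk indep (set xs)"
  shows "rank_bits (xs @ ys) = rank_bits xs @ replicate (length ys) False"
  using assms
proof (induction ys rule: rev_induct)
  case (snoc y ys)
  have "rk indep (set xs) \<le> rk indep (set (xs @ ys))"
    "rk indep (set (xs @ ys)) \<le> rk indep (set (xs @ ys @ [y]))"
    by (rule rk_mono; auto)+
  then have eq: "rk indep (set (xs @ ys)) = rk indep (set xs)" using snoc.prems by linarith
  have "rank_bits ((xs @ ys) @ [y]) = rank_bits (xs @ ys) @ [False]"
    using eq snoc.prems unfolding rank_bits_snoc by simp
  then show ?case using snoc.IH[OF eq] by (simp add: replicate_append_same)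
qed simp

text \<open>The lower part of a flag, as a function on indices so that it can be truncated or
  extended by one flat.\<close>

definition flag_upto :: "(nat \<Rightarrow> 'a set) \<Rightarrow> nat \<Rightarrow> bool" where
  "flag_upto X k \<longleftrightarrow> (\<forall>i\<le>k. X i \<in> flats carrier indep \<and> rk indep (X i) = i) \<and> (\<forall>i<k. X i \<subseteq> X (Suc i))"

lemma flag_upto_mono: "flag_upto X k \<Longrightarrow> i \<le> k \<Longrightarrow> flag_upto X i"
  by (simp add: flag_upto_def)

text \<open>The blocks up to \<open>k\<close> span \<open>X k\<close>. The next leader lies outside
  this flat and raises the rank to \<open>Suc k\<close>; its followers stay in
  \<open>X (Suc k)\<close>, which has that rank, so they contribute only zeros.\<close>

lemma rk_adapted:
  assumes "flag_upto X k" "\<And>i. 1 \<le> i \<Longrightarrow> i \<le> k \<Longrightarrow> 1 \<le> b i" "xs \<in> adapted X b k"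
  shows "rk indep (set xs) = k \<and> rank_bits xs = bit_blocks b k"
  using assms
proof (induction k arbitrary: xs)
  case 0
  then have xs: "set xs \<subseteq> X 0" "rk indep (X 0) = 0" "length xs = b 0" by (auto simp: flag_upto_def)
  then have "rk indep (set xs) = 0" using rk_mono[of "set xs" "X 0"] by simp
  then show ?case using rank_bits_append[of "[]" xs] rk_empty xs by simp
next
  case (Suc k)
  obtain ys x zs where xs: "xs = ys @ x # zs" "ys \<in> adapted X b k" "x \<in> X (Suc k) - X k"
    "set zs \<subseteq> X (Suc k) - insert x (set ys)" "length zs = b (Suc k) - 1"
    using Suc.prems(3) by auto
  have X: "flag_upto X k" using Suc.prems(1) by (rule flag_upto_mono) simp
  have flat: "X k \<in> flats carrier indep" "rk indep (X k) = k" "X k \<subseteq> X (Suc k)"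
    "X (Suc k) \<in> flats carrier indep" "rk indep (X (Suc k)) = Suc k"
    using Suc.prems(1) by (auto simp: flag_upto_def)
  then have "X (Suc k) \<subseteq> carrier" by (simp add: flats_def)
  note flat = flat(1-3,5) this
  have ys: "rk indep (set ys) = k" "rank_bits ys = bit_blocks b k"
    using Suc.IH[OF X _ xs(2)] Suc.prems(2) by auto
  have ysX: "set ys \<subseteq> X k"
    using adaptedD[OF xs(2)] X Suc.prems(2) by (auto simp: flag_upto_def)
  have "closure (set ys) = X k" using closure_eq_flat[OF flat(1) ysX] ys flat by simp
  then have "rk indep (insert x (set ys)) \<noteq> k"
    using xs(3) flat ys by (auto simp: closure_def)
  then have less: "Suc k \<le> rk indep (set (ys @ [x]))"
    using rk_mono[OF subset_insertI[of "set ys" x]] ys by simp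
  have "rk indep (set (ys @ [x])) \<le> rk indep (set xs)" "rk indep (set xs) \<le> rk indep (X (Suc k))"
    by (rule rk_mono; use xs ysX flat in auto)+
  then have eq: "rk indep (set (ys @ [x])) = Suc k" "rk indep (set xs) = Suc k"
    using less flat by auto
  then have "rank_bits ((ys @ [x]) @ zs) = rank_bits (ys @ [x]) @ replicate (length zs) False"
    using xs by (intro rank_bits_append) simp
  then show ?case using eq xs ys by (simp add: rank_bits_snoc)
qed

section \<open>The flag induced by an ordering\<close>

lemma closure_adapted:
  assumes "flag_upto X k" "\<And>i. 1 \<le> i \<Longrightarrow> i \<le> k \<Longrightarrow> 1 \<le> b i" "xs \<in> adapted X b k"
  shows "closure (set xs) = X k"
proof -
  have "set xs \<subseteq> X k" using adaptedD[OF assms(3)] assms by (auto simp: flag_upto_def)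
  then show ?thesis
    using closure_eq_flat[of "X k" "set xs"] rk_adapted[OF assms] assms(1) by (auto simp: flag_upto_def)
qed

text \<open>The flat with index \<open>i\<close> is the closure of the entries in blocks
  \<open>0\<close> to \<open>i\<close>, and these depend only on \<open>xs\<close> and
  \<open>b\<close>.\<close>

lemma adapted_flag_unique:
  assumes "flag_upto X k" "flag_upto Y k" "\<And>i. 1 \<le> i \<Longrightarrow> i \<le> k \<Longrightarrow> 1 \<le> b i"
    and "xs \<in> adapted X b k" "xs \<in> adapted Y b k" "i \<le> k"
  shows "X i = Y i"
proof -
  have "closure (set (take (\<Sum>l\<le>i. b l) xs)) = Z i"
    if Z: "flag_upto Z k" "xs \<in> adapted Z b k" for Z
  proof (rule closure_adapted)
    show "flag_upto Z i" using Z(1) assms(6) by (rule flag_upto_mono)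
    show "take (\<Sum>l\<le>i. b l) xs \<in> adapted Z b i"
      using Z assms(3,6) by (intro take_adapted[where k = k]) (auto simp: flag_upto_def)
  qed (use assms in auto)
  then show ?thesis using assms(1,2,4,5) by metis
qed

text \<open>The flag is read off from left to right. An element of the current closure lengthens the
  last block; any other element opens a new block, and the closure including it becomes the next
  flat.\<close>

lemma adapted_exists:
  assumes "distinct xs" "set xs \<subseteq> carrier"
  shows "\<exists>X b. flag_upto X (rk indep (set xs)) \<and> (\<forall>i\<ge>1. 1 \<le> b i) \<and> xs \<in> adapted X b (rk indep (set xs))"
  using assms
proof (induction xs rule: rev_induct)
  case Nil
  have "flag_upto (\<lambda>_. closure {}) 0"
    using closure_flat[of "{}"] rk_closure[of "{}"] by (simp add: flag_upto_def rk_empty)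
  \<comment> \<open>Block \<open>0\<close> starts empty. The value \<open>1\<close> at later indices
    is a default that only has to be positive.\<close>
  moreover have "[] \<in> adapted (\<lambda>_. closure {}) (\<lambda>i. if i = 0 then 0 else 1) 0" by simp
  moreover have "\<forall>i::nat\<ge>1. 1 \<le> (if i = 0 then 0 else 1 :: nat)" by simp
  ultimately show ?case unfolding list.set(1) rk_empty
    by (intro exI[of _ "\<lambda>_. closure {}"] exI[of _ "\<lambda>i. if i = 0 then 0 else 1"] conjI)
next
  case (snoc x xs)
  let ?k = "rk indep (set xs)"
  have x: "x \<in> carrier" "x \<notin> set xs" "set xs \<subseteq> carrier" using snoc.prems by auto
  obtain X b where X: "flag_upto X ?k" and b: "\<forall>i\<ge>1. 1 \<le> b i" and xs: "xs \<in> adapted X b ?k"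
    using snoc by auto
  have cl: "closure (set xs) = X ?k" using closure_adapted[OF X _ xs] b by blast
  show ?case
  proof (cases "x \<in> X ?k")
    case True
    then have "rk indep (set (xs @ [x])) = ?k" using cl[symmetric] by (simp add: closure_def)
    moreover have "xs @ [x] \<in> adapted X (b(?k := Suc (b ?k))) ?k"
      using adapted_snoc[OF xs True x(2)] b by blast
    moreover have "\<forall>i\<ge>1. 1 \<le> (b(?k := Suc (b ?k))) i" using b by simp
    ultimately show ?thesis using X
      by (intro exI[of _ X] exI[of _ "b(?k := Suc (b ?k))"] conjI) (simp_all only:)
  next
    case False
    \<comment> \<open>Overwriting index \<open>Suc ?k\<close> keeps the flats and blocks to which
      \<open>xs\<close> is already adapted; \<open>x\<close> alone forms the new block.\<close>
    let ?Y = "X(Suc ?k := closure (insert x (set xs)))"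
    let ?c = "b(Suc ?k := 1)"
    have "rk indep (insert x (set xs)) \<noteq> ?k" using False x cl[symmetric] by (simp add: closure_def)
    then have rk: "rk indep (insert x (set xs)) = Suc ?k"
      using rk_insert_le[of x "set xs"] rk_mono[OF subset_insertI[of "set xs" x]] by linarith
    have ins: "insert x (set xs) \<subseteq> carrier" using x by simp
    have sub: "X ?k \<subseteq> closure (insert x (set xs))"
      unfolding cl[symmetric] by (rule closure_mono) blast
    have "flag_upto ?Y (Suc ?k)"
      using X closure_flat[OF ins] rk_closure[OF ins] rk sub
      by (auto simp: flag_upto_def le_Suc_eq less_Suc_eq)
    moreover have "xs \<in> adapted ?Y ?c ?k"
      using xs adapted_cong[of ?k X ?Y b ?c] by simp
    then have "xs @ [x] \<in> adapted ?Y ?c (Suc ?k)"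
      using False closure_extensive[OF ins] by (auto intro!: exI[of _ xs])
    moreover have "\<forall>i\<ge>1. 1 \<le> ?c i" using b by simp
    moreover have "rk indep (set (xs @ [x])) = Suc ?k" using rk by simp
    ultimately show ?thesis
      by (intro exI[of _ ?Y] exI[of _ ?c] conjI) (simp_all only:)
  qed
qed

subsection \<open>Flags\<close>

lemma carrier_flat: "carrier \<in> flats carrier indep"
  by (simp add: flats_def)

definition rank_flags :: "'a set list set" where
  "rank_flags = {Xs. length Xs = Suc (rk indep carrier) \<and> flag_upto ((!) Xs) (rk indep carrier)}"

text \<open>On \<open>rank_flags\<close> the sets are finite and increasing, so the truncated
  subtraction is exact.\<close>

definition flag_type :: "'a set list \<Rightarrow> nat list" where
  "flag_type Xs = map (\<lambda>i. if i = 0 then card (Xs ! 0) else card (Xs ! i) - card (Xs ! (i - 1))) [0..<length Xs]"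

lemma flag_upto_less:
  assumes "flag_upto X k" "i < j" "j \<le> k"
  shows "X i \<subset> X j"
proof -
  have "X i \<subseteq> X j"
    using assms(2,3)
  proof (induction j)
    case (Suc j)
    then have "X j \<subseteq> X (Suc j)" using assms(1) by (simp add: flag_upto_def)
    then show ?case using Suc by (cases "i = j") auto
  qed simp
  moreover have "rk indep (X i) = i" "rk indep (X j) = j" using assms by (auto simp: flag_upto_def)
  ultimately show ?thesis using assms(2) by auto
qed

text \<open>Links the index description to maximal chains under the side conditions of
  \<open>nu\<close>. For maximality, a flat in a larger chain is comparable to the flat of the same
  rank in \<open>Xs\<close>, and comparable flats of equal rank coincide.\<close>

lemma rank_flags_eq:
  "rank_flags = {Xs \<in> flags carrier indep. length Xs = Suc (rk indep carrier) \<and>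
     (\<forall>i<Suc (rk indep carrier). rk indep (Xs ! i) = i)}"
proof (intro equalityI subsetI)
  fix Xs assume Xs: "Xs \<in> rank_flags"
  let ?r = "rk indep carrier"
  have len: "length Xs = Suc ?r" and flag: "flag_upto ((!) Xs) ?r"
    using Xs by (auto simp: rank_flags_def)
  have flat: "Xs ! i \<in> flats carrier indep" "rk indep (Xs ! i) = i" if "i \<le> ?r" for i
    using flag that by (auto simp: flag_upto_def)
  have sorted: "sorted_wrt (\<subset>) Xs"
    using flag_upto_less[OF flag] len by (simp add: sorted_wrt_iff_nth_less)
  have chain: "subset.chain (flats carrier indep) (set Xs)"
    unfolding subset.chain_def
  proof (intro conjI ballI)
    show "set Xs \<subseteq> flats carrier indep" using flat len by (auto simp: in_set_conv_nth)
    fix U V assume "U \<in> set Xs" "V \<in> set Xs"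
    then obtain i j where "i < length Xs" "j < length Xs" "U = Xs ! i" "V = Xs ! j"
      by (auto simp: in_set_conv_nth)
    then show "(\<subset>)\<^sup>=\<^sup>= U V \<or> (\<subset>)\<^sup>=\<^sup>= V U"
      using flag_upto_less[OF flag, of i j] flag_upto_less[OF flag, of j i] len
      by (cases i j rule: linorder_cases) auto
  qed
  have "U \<in> set Xs" if C: "subset.chain (flats carrier indep) C" "set Xs \<subseteq> C" "U \<in> C" for C U
  proof -
    have U: "U \<in> flats carrier indep" using C by (auto simp: subset.chain_def)
    then have "rk indep U \<le> ?r" by (auto simp: flats_def intro: rk_mono)
    then have V: "Xs ! rk indep U \<in> set Xs" "Xs ! rk indep U \<in> flats carrier indep"
      "rk indep (Xs ! rk indep U) = rk indep U"
      using flat len by auto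
    then have "U \<subseteq> Xs ! rk indep U \<or> Xs ! rk indep U \<subseteq> U"
      using C unfolding subset.chain_def by blast
    then have "U = Xs ! rk indep U" using flat_eqI U V by metis
    then show ?thesis using V by simp
  qed
  then have "subset.maxchain (flats carrier indep) (set Xs)"
    using chain unfolding subset.maxchain_def by blast
  then show "Xs \<in> {Xs \<in> flags carrier indep. length Xs = Suc ?r \<and> (\<forall>i<Suc ?r. rk indep (Xs ! i) = i)}"
    using sorted len flat by (simp add: flags_def)
next
  fix Xs assume Xs: "Xs \<in> {Xs \<in> flags carrier indep. length Xs = Suc (rk indep carrier) \<and>
     (\<forall>i<Suc (rk indep carrier). rk indep (Xs ! i) = i)}"
  then have "set Xs \<subseteq> flats carrier indep" "sorted_wrt (\<subset>) Xs"
    by (auto simp: flags_def subset.maxchain_def subset.chain_def)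
  moreover from this have "Xs ! i \<subseteq> Xs ! Suc i" if "i < rk indep carrier" for i
    using that Xs sorted_wrt_nth_less[of "(\<subset>)" Xs i "Suc i"] by auto
  ultimately show "Xs \<in> rank_flags"
    using Xs by (auto simp: rank_flags_def flag_upto_def less_Suc_eq_le)
qed

lemma finite_rank_flags: "finite rank_flags"
proof (rule finite_subset)
  have "set Xs \<subseteq> flats carrier indep" if "Xs \<in> rank_flags" for Xs
    using that by (auto simp: rank_flags_def flag_upto_def in_set_conv_nth less_Suc_eq_le)
  moreover have "flats carrier indep \<subseteq> Pow carrier" by (auto simp: flats_def)
  ultimately show "rank_flags \<subseteq> {Xs. set Xs \<subseteq> Pow carrier \<and> length Xs = Suc (rk indep carrier)}"
    by (fastforce simp: rank_flags_def)
  show "finite {Xs. set Xs \<subseteq> Pow carrier \<and> length Xs = Suc (rk indep carrier)}"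
    by (rule finite_lists_length_eq) (simp add: finite_carrier)
qed

lemma rank_flagsD:
  assumes "Xs \<in> rank_flags"
  shows "finite (Xs ! 0)" "\<And>i. i \<le> rk indep carrier \<Longrightarrow> finite (Xs ! i)"
    "\<And>i. i < rk indep carrier \<Longrightarrow> Xs ! i \<subseteq> Xs ! Suc i"
    "\<And>i. i < rk indep carrier \<Longrightarrow> card (Xs ! Suc i) = card (Xs ! i) + flag_type Xs ! Suc i"
    "flag_type Xs ! 0 = card (Xs ! 0)"
    "\<And>i. 1 \<le> i \<Longrightarrow> i \<le> rk indep carrier \<Longrightarrow> 1 \<le> flag_type Xs ! i"
    "length (flag_type Xs) = Suc (rk indep carrier)"
    "Xs ! rk indep carrier = carrier"
proof -
  have flag: "flag_upto ((!) Xs) (rk indep carrier)" and len: "length Xs = Suc (rk indep carrier)"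
    using assms by (auto simp: rank_flags_def)
  show fin: "finite (Xs ! i)" if "i \<le> rk indep carrier" for i
  proof -
    have "Xs ! i \<in> flats carrier indep" using flag that by (simp add: flag_upto_def)
    then have "Xs ! i \<subseteq> carrier" by (simp add: flats_def)
    then show ?thesis using finite_carrier by (rule finite_subset)
  qed
  then show "finite (Xs ! 0)" by simp
  show sub: "Xs ! i \<subseteq> Xs ! Suc i" if "i < rk indep carrier" for i
    using flag that by (simp add: flag_upto_def)
  show "card (Xs ! Suc i) = card (Xs ! i) + flag_type Xs ! Suc i" if "i < rk indep carrier" for i
    using card_mono[OF fin sub[OF that]] that len by (simp add: flag_type_def del: upt_Suc)
  show "flag_type Xs ! 0 = card (Xs ! 0)" "length (flag_type Xs) = Suc (rk indep carrier)"
    using len by (simp_all add: flag_type_def del: upt_Suc)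
  show "1 \<le> flag_type Xs ! i" if "1 \<le> i" "i \<le> rk indep carrier" for i
    using psubset_card_mono[OF fin flag_upto_less[OF flag], of i "i - 1"] that len
    by (simp add: flag_type_def del: upt_Suc)
  show "Xs ! rk indep carrier = carrier"
  proof (intro flat_eqI carrier_flat)
    show "Xs ! rk indep carrier \<in> flats carrier indep" "rk indep (Xs ! rk indep carrier) = rk indep carrier"
      using flag by (auto simp: flag_upto_def)
    then show "Xs ! rk indep carrier \<subseteq> carrier" by (simp add: flats_def)
  qed
qed

lemma card_rank_flag:
  assumes "Xs \<in> rank_flags" "i \<le> rk indep carrier"
  shows "card (Xs ! i) = (\<Sum>l\<le>i. flag_type Xs ! l)"
  using assms(2) by (induction i) (simp_all add: rank_flagsD[OF assms(1)])

lemma flag_type_composition: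
  "Xs \<in> rank_flags \<Longrightarrow> flag_type Xs \<in> compositions (card carrier) (rk indep carrier)"
  using card_rank_flag[of Xs "rk indep carrier"] rank_flagsD[of Xs] by (simp add: compositions_def)

text \<open>The conditions in \<open>nu\<close> split into those defining \<open>rank_flags\<close>
  and those on cardinalities, which fix the type.\<close>

lemma nu_eq:
  assumes "length a = Suc (rk indep carrier)"
  shows "nu carrier indep a = card {Xs \<in> rank_flags. flag_type Xs = a}"
proof -
  have "(card (Xs ! 0) = a ! 0 \<and> (\<forall>i. 1 \<le> i \<and> i < length a \<longrightarrow>
      int (card (Xs ! i)) - int (card (Xs ! (i - 1))) = int (a ! i))) \<longleftrightarrow> flag_type Xs = a"
    if Xs: "Xs \<in> rank_flags" for Xs
  proof -
    have step: "int (card (Xs ! i)) - int (card (Xs ! (i - 1))) = int (flag_type Xs ! i)"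
      if "1 \<le> i" "i < length a" for i
      using that rank_flagsD(4)[OF Xs, of "i - 1"] assms by simp
    have "flag_type Xs = a \<longleftrightarrow> (\<forall>i<length a. flag_type Xs ! i = a ! i)"
      using rank_flagsD(7)[OF Xs] assms by (simp add: list_eq_iff_nth_eq)
    also have "\<dots> \<longleftrightarrow> flag_type Xs ! 0 = a ! 0 \<and> (\<forall>i. 1 \<le> i \<and> i < length a \<longrightarrow> flag_type Xs ! i = a ! i)"
      using assms by (metis less_one linorder_not_less zero_less_Suc)
    finally show ?thesis using step rank_flagsD(5)[OF Xs] by simp
  qed
  then show ?thesis
    unfolding nu_def assms rank_flags_eq by (intro arg_cong[of _ _ card]) auto
qed

subsection \<open>Counting orderings by flag and composition\<close>

lemma card_adapted_flag:
  assumes "Xs \<in> rank_flags" "b \<in> compositions (card carrier) (rk indep carrier)"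
  shows "int (card (adapted ((!) Xs) ((!) b) (rk indep carrier))) = gamma_coeff (rk indep carrier) (flag_type Xs) b"
  unfolding gamma_coeff_def using rank_flagsD[OF assms(1)] assms(2)
  by (intro card_adapted) (simp_all add: compositions_def)

text \<open>Blocks \<open>0\<close> to \<open>i\<close> consist of distinct elements of
  \<open>Xs ! i\<close>, so each partial sum of \<open>b\<close> is bounded by the size of that
  flat, a partial sum of the type.\<close>

lemma dominates_if_adapted:
  assumes "Xs \<in> rank_flags" "b \<in> compositions (card carrier) (rk indep carrier)"
    and "xs \<in> adapted ((!) Xs) ((!) b) (rk indep carrier)"
  shows "bits b \<unrhd> bits (flag_type Xs)"
proof -
  let ?r = "rk indep carrier"
  have b: "length b = Suc ?r" "\<And>i. 1 \<le> i \<Longrightarrow> i \<le> ?r \<Longrightarrow> 1 \<le> b ! i"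
    using assms(2) by (auto simp: compositions_def)
  have "(\<Sum>l\<le>i. b ! l) \<le> (\<Sum>l\<le>i. flag_type Xs ! l)" if i: "i \<le> ?r" for i
  proof -
    have "take (\<Sum>l\<le>i. b ! l) xs \<in> adapted ((!) Xs) ((!) b) i"
      using assms i b rank_flagsD[OF assms(1)] by (intro take_adapted[where k = ?r]) auto
    then have "distinct (take (\<Sum>l\<le>i. b ! l) xs) \<and> set (take (\<Sum>l\<le>i. b ! l) xs) \<subseteq> Xs ! i \<and>
        length (take (\<Sum>l\<le>i. b ! l) xs) = (\<Sum>l\<le>i. b ! l)"
      using i b rank_flagsD[OF assms(1)] by (intro adaptedD) auto
    then have "(\<Sum>l\<le>i. b ! l) \<le> card (Xs ! i)"
      using card_mono[OF rank_flagsD(2)[OF assms(1) i]] distinct_card by metis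
    then show ?thesis using card_rank_flag[OF assms(1) i] by simp
  qed
  then show ?thesis
    using bit_blocks_dominates[of ?r "(!) (flag_type Xs)" "(!) b"] b rank_flagsD[OF assms(1)]
    by (simp add: bits_eq_bit_blocks)
qed

lemma rank_bits_adapted:
  assumes "Xs \<in> rank_flags" "b \<in> compositions (card carrier) (rk indep carrier)"
    and "xs \<in> adapted ((!) Xs) ((!) b) (rk indep carrier)"
  shows "rank_bits xs = bits b" "xs \<in> permutations_of_set carrier"
proof -
  let ?r = "rk indep carrier"
  have b: "length b = Suc ?r" "\<And>i. 1 \<le> i \<Longrightarrow> i \<le> ?r \<Longrightarrow> 1 \<le> b ! i"
    using assms(2) by (auto simp: compositions_def)
  have flag: "flag_upto ((!) Xs) ?r" using assms(1) by (simp add: rank_flags_def)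
  show "rank_bits xs = bits b"
    using rk_adapted[OF flag _ assms(3)] b by (simp add: bits_eq_bit_blocks)
  have "distinct xs \<and> set xs \<subseteq> Xs ! ?r \<and> length xs = (\<Sum>i\<le>?r. b ! i)"
    using b rank_flagsD[OF assms(1)] by (intro adaptedD assms(3)) auto
  then have "distinct xs" "set xs \<subseteq> carrier" "length xs = card carrier"
    using assms(2) rank_flagsD(8)[OF assms(1)] by (auto simp: compositions_def)
  moreover have "set xs = carrier"
    using calculation finite_carrier by (metis card_subset_eq distinct_card)
  ultimately show "xs \<in> permutations_of_set carrier" by (intro permutations_of_setI)
qed

text \<open>The rank sequence of \<open>xs\<close> determines the composition by injectivity of
  \<open>bits\<close>, and then \<open>xs\<close> determines the flats.\<close>

lemma adapted_disjoint:
  assumes "Xs \<in> rank_flags" "b \<in> compositions (card carrier) (rk indep carrier)"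
    and "Ys \<in> rank_flags" "c \<in> compositions (card carrier) (rk indep carrier)"
    and "xs \<in> adapted ((!) Xs) ((!) b) (rk indep carrier)" "xs \<in> adapted ((!) Ys) ((!) c) (rk indep carrier)"
  shows "Xs = Ys \<and> b = c"
proof -
  have "bits b = bits c"
    using rank_bits_adapted(1)[of Xs b xs] rank_bits_adapted(1)[of Ys c xs] assms by simp
  then have bc: "b = c" using assms(2,4) bits_inj_on_compositions by (auto dest: inj_onD)
  have "Xs ! i = Ys ! i" if "i \<le> rk indep carrier" for i
    using assms(1-4) by (intro adapted_flag_unique[OF _ _ _ assms(5)[unfolded bc] assms(6) that])
      (auto simp: rank_flags_def compositions_def)
  then have "Xs = Ys"
    using assms(1,3) by (auto simp: rank_flags_def list_eq_iff_nth_eq)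
  then show ?thesis using bc by simp
qed

lemma adapted_cover:
  assumes "xs \<in> permutations_of_set carrier"
  shows "\<exists>Xs\<in>rank_flags. \<exists>b\<in>compositions (card carrier) (rk indep carrier).
    xs \<in> adapted ((!) Xs) ((!) b) (rk indep carrier)"
proof -
  let ?r = "rk indep carrier"
  have xs: "distinct xs" "set xs = carrier" using assms permutations_of_setD by auto
  obtain X b where X: "flag_upto X ?r" and b: "\<forall>i\<ge>1. 1 \<le> b i" and ad: "xs \<in> adapted X b ?r"
    using adapted_exists[of xs] xs by auto
  \<comment> \<open>Only indices up to \<open>?r\<close> matter, so the two functions can be cut
    down to lists.\<close>
  define Xs where "Xs = map X [0..<Suc ?r]"
  define c where "c = map b [0..<Suc ?r]"
  have nth: "Xs ! i = X i" "c ! i = b i" if "i \<le> ?r" for i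
    using that nth_map[of i "[0..<Suc ?r]"] unfolding Xs_def c_def by (simp_all del: upt_Suc)
  have "Xs \<in> rank_flags"
    using X nth by (simp add: rank_flags_def flag_upto_def) (simp add: Xs_def)
  moreover have "length xs = (\<Sum>i\<le>?r. b i)"
    using adaptedD[OF ad] X b by (auto simp: flag_upto_def)
  then have "card carrier = (\<Sum>i\<le>?r. c ! i)" using nth xs distinct_card[of xs] by simp
  then have "c \<in> compositions (card carrier) ?r"
    using b nth by (simp add: compositions_def) (simp add: c_def)
  moreover have "xs \<in> adapted ((!) Xs) ((!) c) ?r"
    using ad adapted_cong[of ?r "(!) Xs" X "(!) c" b] nth by simp
  ultimately show ?thesis by blast
qed

text \<open>The sets of adapted lists, over all pairs of a flag and a composition, partition the
  orderings. On each of them the rank sequence is constant, and its size is a coefficient of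
  \<open>gamma\<close>. The weight \<open>f\<close> is left arbitrary so that
  \<open>Sp_symbol\<close> can be put in its place.\<close>

lemma sum_rank_bits:
  fixes f :: "bool list \<Rightarrow> 'b::comm_ring_1"
  shows "(\<Sum>xs\<in>permutations_of_set carrier. f (rank_bits xs)) =
    (\<Sum>a\<in>compositions (card carrier) (rk indep carrier). of_nat (nu carrier indep a) *
       (\<Sum>b\<in>{b \<in> compositions (card carrier) (rk indep carrier). bits b \<unrhd> bits a}.
          of_int (gamma_coeff (rk indep carrier) a b) * f (bits b)))"
proof -
  let ?r = "rk indep carrier"
  let ?C = "compositions (card carrier) ?r"
  let ?P = "\<lambda>(Xs, b). adapted ((!) Xs) ((!) b) ?r"
  let ?g = "\<lambda>a. \<Sum>b\<in>{b \<in> ?C. bits b \<unrhd> bits a}. of_int (gamma_coeff ?r a b) * f (bits b)"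
  have "permutations_of_set carrier = (\<Union>p\<in>rank_flags \<times> ?C. ?P p)"
    using adapted_cover rank_bits_adapted(2) by fastforce
  then have "(\<Sum>xs\<in>permutations_of_set carrier. f (rank_bits xs)) =
      (\<Sum>xs\<in>(\<Union>p\<in>rank_flags \<times> ?C. ?P p). f (rank_bits xs))"
    by simp
  also have "\<dots> = (\<Sum>p\<in>rank_flags \<times> ?C. \<Sum>xs\<in>?P p. f (rank_bits xs))"
  proof (rule sum.UNION_disjoint)
    show "finite (rank_flags \<times> ?C)" using finite_rank_flags finite_compositions by simp
    show "\<forall>p\<in>rank_flags \<times> ?C. finite (?P p)"
      by (auto intro!: finite_adapted rank_flagsD(2))
    show "\<forall>p\<in>rank_flags \<times> ?C. \<forall>q\<in>rank_flags \<times> ?C. p \<noteq> q \<longrightarrow> ?P p \<inter> ?P q = {}"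
      using adapted_disjoint by fastforce
  qed
  also have "\<dots> = (\<Sum>Xs\<in>rank_flags. \<Sum>b\<in>?C. \<Sum>xs\<in>?P (Xs, b). f (rank_bits xs))"
    by (simp add: sum.cartesian_product split_beta)
  also have "\<dots> = (\<Sum>Xs\<in>rank_flags. ?g (flag_type Xs))"
  proof (rule sum.cong[OF refl])
    fix Xs assume Xs: "Xs \<in> rank_flags"
    have "(\<Sum>xs\<in>?P (Xs, b). f (rank_bits xs)) = of_int (gamma_coeff ?r (flag_type Xs) b) * f (bits b)"
      if b: "b \<in> ?C" for b
    proof -
      have "(\<Sum>xs\<in>?P (Xs, b). f (rank_bits xs)) = (\<Sum>xs\<in>?P (Xs, b). f (bits b))"
        using rank_bits_adapted(1)[OF Xs b] by (intro sum.cong) auto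
      also have "\<dots> = of_int (int (card (?P (Xs, b)))) * f (bits b)" by simp
      finally show ?thesis using card_adapted_flag[OF Xs b] by simp
    qed
    then have "(\<Sum>b\<in>?C. \<Sum>xs\<in>?P (Xs, b). f (rank_bits xs)) =
        (\<Sum>b\<in>?C. of_int (gamma_coeff ?r (flag_type Xs) b) * f (bits b))"
      by (intro sum.cong) auto
    \<comment> \<open>Compositions that fail to dominate have no adapted lists, so their coefficient
      is zero and they may be dropped.\<close>
    also have "\<dots> = ?g (flag_type Xs)"
    proof (rule sum.mono_neutral_right)
      show "\<forall>b\<in>?C - {b \<in> ?C. bits b \<unrhd> bits (flag_type Xs)}.
          of_int (gamma_coeff ?r (flag_type Xs) b) * f (bits b) = 0"
      proof
        fix b assume b: "b \<in> ?C - {b \<in> ?C. bits b \<unrhd> bits (flag_type Xs)}"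
        then have "adapted ((!) Xs) ((!) b) ?r = {}" using dominates_if_adapted[OF Xs] by blast
        then have "gamma_coeff ?r (flag_type Xs) b = 0" using card_adapted_flag[OF Xs, of b] b by simp
        then show "of_int (gamma_coeff ?r (flag_type Xs) b) * f (bits b) = 0" by simp
      qed
    qed (auto simp: finite_compositions)
    finally show "(\<Sum>b\<in>?C. \<Sum>xs\<in>?P (Xs, b). f (rank_bits xs)) = ?g (flag_type Xs)" .
  qed
  \<comment> \<open>The contribution of a flag depends only on its type, so grouping by type
    produces \<open>nu\<close>.\<close>
  also have "\<dots> = (\<Sum>a\<in>?C. \<Sum>Xs\<in>{Xs \<in> rank_flags. flag_type Xs = a}. ?g (flag_type Xs))"
    using flag_type_composition
    by (intro sum.group[symmetric] finite_rank_flags finite_compositions) auto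
  also have "\<dots> = (\<Sum>a\<in>?C. of_nat (nu carrier indep a) * ?g a)"
    by (intro sum.cong refl) (simp add: nu_eq compositions_def)
  finally show ?thesis .
qed

end

subsection \<open>Specialization to the Tutte polynomial\<close>

lemma scale_eq: "scale c p = [:[:c:]:] * p"
  by (simp add: scale_def)

lemma scale_of_int: "scale (of_int k) p = of_int k * p"
  by (simp add: scale_eq of_int_poly)

lemma scale_sum: "scale c (\<Sum>x\<in>A. f x) = (\<Sum>x\<in>A. scale c (f x))"
  by (simp add: scale_eq sum_distrib_left)

lemma Sp_sum: "finite A \<Longrightarrow> Sp n r (\<Sum>x\<in>A. g x) = (\<Sum>x\<in>A. Sp n r (g x))"
  by (induction A rule: finite_induct) (simp_all add: Sp_add, simp add: Sp_def)

lemma gamma_bar_eq: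
  "gamma_bar n r a = (\<Sum>b\<in>{b \<in> compositions n r. bits b \<unrhd> bits a}.
     of_int (gamma_coeff r a b) * Sp_symbol n r (bits b))"
  unfolding gamma_bar_def gamma_def
  by (subst Sp_sum) (simp_all add: finite_compositions Sp_single scale_of_int)

text \<open>Such an ordering is an ordering of \<open>A\<close> followed by one of
  \<open>S - A\<close>.\<close>

lemma card_permutations_with_prefix_set:
  assumes "finite S" "A \<subseteq> S"
  shows "card {xs \<in> permutations_of_set S. set (take (card A) xs) = A} = fact (card A) * fact (card S - card A)"
proof -
  have "{xs \<in> permutations_of_set S. set (take (card A) xs) = A} =
    (\<lambda>(ys, zs). ys @ zs) ` (permutations_of_set A \<times> permutations_of_set (S - A))"
  proof (intro equalityI subsetI)
    fix xs assume "xs \<in> {xs \<in> permutations_of_set S. set (take (card A) xs) = A}"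
    then have xs: "set xs = S" "distinct xs" "set (take (card A) xs) = A"
      using permutations_of_setD by auto
    let ?ys = "take (card A) xs" and ?zs = "drop (card A) xs"
    have "set ?ys \<union> set ?zs = S" by (metis append_take_drop_id set_append xs(1))
    moreover have "set ?ys \<inter> set ?zs = {}" using xs(2) by (simp add: set_take_disj_set_drop_if_distinct)
    ultimately have "set ?zs = S - A" using xs(3) by auto
    then have "(?ys, ?zs) \<in> permutations_of_set A \<times> permutations_of_set (S - A)"
      using xs by (auto intro!: permutations_of_setI)
    moreover have "xs = (\<lambda>(ys, zs). ys @ zs) (?ys, ?zs)" by simp
    ultimately show "xs \<in> (\<lambda>(ys, zs). ys @ zs) ` (permutations_of_set A \<times> permutations_of_set (S - A))"
      by (rule rev_image_eqI)
  next
    fix xs assume "xs \<in> (\<lambda>(ys, zs). ys @ zs) ` (permutations_of_set A \<times> permutations_of_set (S - A))"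
    then obtain ys zs where "xs = ys @ zs" "ys \<in> permutations_of_set A" "zs \<in> permutations_of_set (S - A)"
      by auto
    then have "xs = ys @ zs" "set ys = A" "distinct ys" "set zs = S - A" "distinct zs"
      by (auto dest: permutations_of_setD)
    then show "xs \<in> {xs \<in> permutations_of_set S. set (take (card A) xs) = A}"
      using assms distinct_card[of ys] by (auto intro!: permutations_of_setI)
  qed
  moreover have "inj_on (\<lambda>(ys, zs). ys @ zs) (permutations_of_set A \<times> permutations_of_set (S - A))"
    by (auto simp: inj_on_def dest!: length_finite_permutations_of_set)
  ultimately show ?thesis
    using assms by (simp add: card_image card_cartesian_product card_Diff_subset finite_subset)
qed

section \<open>The Tutte polynomial as a sum over orderings\<close>

context matroid
begin

lemma sum_prefix_sets:
  fixes h :: "'a set \<Rightarrow> 'b::{comm_semiring_1, semiring_char_0}"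
  assumes "m \<le> card carrier"
  shows "(\<Sum>xs\<in>permutations_of_set carrier. h (set (take m xs))) =
    fact m * fact (card carrier - m) * (\<Sum>A\<in>{A. A \<subseteq> carrier \<and> card A = m}. h A)"
proof -
  let ?A = "{A. A \<subseteq> carrier \<and> card A = m}"
  have "(\<Sum>xs\<in>permutations_of_set carrier. h (set (take m xs))) =
      (\<Sum>A\<in>?A. \<Sum>xs\<in>{xs \<in> permutations_of_set carrier. set (take m xs) = A}. h (set (take m xs)))"
  proof (rule sum.group[symmetric])
    show "(\<lambda>xs. set (take m xs)) ` permutations_of_set carrier \<subseteq> ?A"
    proof (rule image_subsetI)
      fix xs assume xs: "xs \<in> permutations_of_set carrier"
      then have "card (set (take m xs)) = m"
        using assms by (simp add: distinct_card permutations_of_setD length_finite_permutations_of_set)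
      then show "set (take m xs) \<in> ?A" using xs set_take_subset[of m xs] by (auto dest: permutations_of_setD)
    qed
  qed (simp_all add: finite_carrier)
  also have "\<dots> = (\<Sum>A\<in>?A. fact m * fact (card carrier - m) * h A)"
    using card_permutations_with_prefix_set[OF finite_carrier] by (intro sum.cong) auto
  finally show ?thesis by (simp add: sum_distrib_left)
qed

text \<open>The term of index \<open>m\<close> in \<open>Sp_symbol\<close> depends only on the set
  of the first \<open>m\<close> elements. Exchanging the sums and collecting orderings by that set
  leaves one sum over all subsets, up to a factor that cancels \<open>1 / fact ?n\<close>.\<close>

lemma sum_Sp_symbol_rank_bits:
  "(\<Sum>xs\<in>permutations_of_set carrier. Sp_symbol (card carrier) (rk indep carrier) (rank_bits xs)) =
    (tutte carrier indep :: 'k::field_char_0 poly poly)"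
proof -
  let ?n = "card carrier" and ?r = "rk indep carrier"
  define h :: "'a set \<Rightarrow> 'k poly poly" where
    "h A = (var_x - 1) ^ (?r - rk indep A) * (var_y - 1) ^ (card A - rk indep A)" for A
  have "Sp_symbol ?n ?r (rank_bits xs) =
      scale (1 / fact ?n) (\<Sum>m\<le>?n. of_nat (?n choose m) * h (set (take m xs)))"
    if xs: "xs \<in> permutations_of_set carrier" for xs
  proof -
    have "card (set (take m xs)) = m" if "m \<le> ?n" for m
      using xs that by (simp add: distinct_card permutations_of_setD length_finite_permutations_of_set)
    then show ?thesis
      unfolding Sp_symbol_def Let_def take_rank_bits count_rank_bits h_def
      by (intro arg_cong[of _ _ "scale (1 / fact ?n)"] sum.cong) (simp_all add: mult.assoc)
  qed
  then have "(\<Sum>xs\<in>permutations_of_set carrier. Sp_symbol ?n ?r (rank_bits xs)) =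
      scale (1 / fact ?n) (\<Sum>xs\<in>permutations_of_set carrier. \<Sum>m\<le>?n. of_nat (?n choose m) * h (set (take m xs)))"
    by (simp add: scale_sum)
  also have "(\<Sum>xs\<in>permutations_of_set carrier. \<Sum>m\<le>?n. of_nat (?n choose m) * h (set (take m xs))) =
      (\<Sum>m\<le>?n. of_nat (?n choose m) * (\<Sum>xs\<in>permutations_of_set carrier. h (set (take m xs))))"
    by (subst sum.swap) (simp add: sum_distrib_left)
  also have "\<dots> = (\<Sum>m\<le>?n. fact ?n * (\<Sum>A\<in>{A. A \<subseteq> carrier \<and> card A = m}. h A))"
  proof (rule sum.cong[OF refl])
    fix m assume m: "m \<in> {..?n}"
    \<comment> \<open>The binomial weight turns the number of orderings with a given initial
      \<open>m\<close>-set into \<open>fact ?n\<close>, independently of \<open>m\<close>.\<close>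
    have "of_nat (?n choose m) * (fact m * fact (?n - m)) = (of_nat (fact ?n) :: 'k poly poly)"
      using binomial_fact_lemma[of m ?n] m
      by (metis atMost_iff mult.commute of_nat_fact of_nat_mult)
    then show "of_nat (?n choose m) * (\<Sum>xs\<in>permutations_of_set carrier. h (set (take m xs))) =
        fact ?n * (\<Sum>A\<in>{A. A \<subseteq> carrier \<and> card A = m}. h A)"
      using sum_prefix_sets[of m h] m by (simp add: mult.assoc[symmetric])
  qed
  also have "\<dots> = fact ?n * (\<Sum>m\<le>?n. \<Sum>A\<in>{A \<in> Pow carrier. card A = m}. h A)"
    by (simp add: sum_distrib_left)
  also have "(\<Sum>m\<le>?n. \<Sum>A\<in>{A \<in> Pow carrier. card A = m}. h A) = (\<Sum>A\<in>Pow carrier. h A)"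
    by (rule sum.group) (auto simp: finite_carrier card_mono)
  also have "(\<Sum>A\<in>Pow carrier. h A) = tutte carrier indep"
    by (simp add: tutte_def h_def)
  also have "scale (1 / fact ?n) (fact ?n * tutte carrier indep) = (tutte carrier indep :: 'k poly poly)"
  proof -
    \<comment> \<open>As a constant polynomial, the factorial can be inverted by
      \<open>scale\<close>.\<close>
    have "(fact ?n :: 'k poly poly) = [:[:fact ?n:]:]"
      by (metis of_nat_fact of_nat_poly)
    then have "scale (1 / fact ?n) (fact ?n * p) = p" for p :: "'k poly poly"
      by (simp add: scale_def) (simp flip: one_pCons)
    then show ?thesis .
  qed
  finally show ?thesis .
qed

lemma tutte_eq_sum_gamma_bar:
  "(tutte carrier indep :: 'k::field_char_0 poly poly) =
    (\<Sum>a\<in>compositions (card carrier) (rk indep carrier).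
       of_nat (nu carrier indep a) * gamma_bar (card carrier) (rk indep carrier) a)"
  unfolding gamma_bar_eq sum_Sp_symbol_rank_bits[symmetric] by (rule sum_rank_bits)

end

theorem theorem4p3:
  fixes n r :: nat and indep :: "nat set \<Rightarrow> bool"
  assumes "matroid {1..n} indep"
    and "rk indep {1..n} = r"
  shows "(\<exists>c :: nat list \<Rightarrow> nat.
            (tutte {1..n} indep :: 'k::field_char_0 poly poly) =
              (\<Sum>a\<in>compositions n r. of_nat (c a) * gamma_bar n r a)) \<and>
         (tutte {1..n} indep :: 'k poly poly) =
           (\<Sum>a\<in>compositions n r. of_nat (nu {1..n} indep a) * gamma_bar n r a)"
proof -
  have "(tutte {1..n} indep :: 'k poly poly) =
      (\<Sum>a\<in>compositions n r. of_nat (nu {1..n} indep a) * gamma_bar n r a)"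
    using matroid.tutte_eq_sum_gamma_bar[OF assms(1), where 'k = 'k] assms(2) by simp
  \<comment> \<open>The numbers \<open>nu {1..n} indep a\<close> serve as the coefficients
    \<open>c a\<close>.\<close>
  then show ?thesis by blast
qed

end
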